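(* Let $m>2$ and $k$ be integers with $0<k<2^m$ and $3 \mid k$, and let $N=k\cdot 2^m-1$. Suppose that one of the following holds: (i) $k \equiv 1 \pmod{10}$ and $m \equiv 2,3 \pmod{4}$; (ii) $k \equiv 3 \pmod{10}$ and $m \equiv 0,3 \pmod{4}$; (iii) $k \equiv 7 \pmod{10}$ and $m \equiv 1,2 \pmod{4}$; (iv) $k \equiv 9 \pmod{10}$ and $m \equiv 0,1 \pmod{4}$. Let $x=V_k(3,1)$. Then $N$ is prime if and only if $N \mid S_{m-2}(x)$.
   Context: For $P,Q\in\mathbb{Z}$ the Lucas sequence $\{V_n(P,Q)\}$ is defined by $V_0(P,Q)=2$, $V_1(P,Q)=P$, $V_{n+1}(P,Q)=PV_n(P,Q)-QV_{n-1}(P,Q)$ for $n\ge 1$. For an integer $x$, the sequence $S_n(x)$ is defined by $S_0(x)=x$ and $S_{j+1}(x)=(S_j(x))^2-2$ for $j\ge 0$. *)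

theory Defs
  imports "HOL-Number_Theory.Number_Theory"
begin

fun lucas_V :: "int \<Rightarrow> int \<Rightarrow> nat \<Rightarrow> int" where
  "lucas_V P Q 0 = 2"
| "lucas_V P Q (Suc 0) = P"
| "lucas_V P Q (Suc (Suc n)) = P * lucas_V P Q (Suc n) - Q * lucas_V P Q n"

primrec S_seq :: "int \<Rightarrow> nat \<Rightarrow> int" where
  "S_seq x 0 = x"
| "S_seq x (Suc j) = (S_seq x j)\<^sup>2 - 2"

end

theory Submission
  imports Defs
begin

text \<open>
  Let \<open>\<phi>\<close> be the golden ratio and \<open>\<psi> = 1 - \<phi>\<close> its conjugate, so that \<open>\<phi>\<psi> = -1\<close> and
  \<open>V\<^sub>n(3,1) = \<phi>\<^bsup>2n\<^esup> + \<psi>\<^bsup>2n\<^esup>\<close>.  Squaring shows that \<open>S\<^bsub>m-2\<^esub>(x) = V\<^sub>n(3,1)\<close> for \<open>n = k 2\<^bsup>m-2\<^esup>\<close>,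
  and since \<open>4n = N + 1\<close>, an integer \<open>q\<close> divides it iff \<open>\<phi>\<^bsup>N+1\<^esup> \<equiv> -1\<close> modulo \<open>q\<close> in \<open>\<int>[\<phi>]\<close>.
  The congruence conditions say that \<open>N \<equiv> \<plusminus>2 (mod 5)\<close>.  Every odd prime \<open>q \<equiv> \<plusminus>2 (mod 5)\<close> is inert
  in \<open>\<int>[\<phi>]\<close>, so \<open>\<phi>\<^sup>q \<equiv> \<psi>\<close> and \<open>\<phi>\<^bsup>q+1\<^esup> \<equiv> -1\<close> modulo \<open>q\<close>.  This settles one direction.
  Conversely, \<open>N\<close> has a prime factor \<open>q \<equiv> \<plusminus>2 (mod 5)\<close>; if \<open>2\<^sup>m\<close> did not divide \<open>q + 1\<close>, a common
  multiple of \<open>N + 1\<close> and \<open>q + 1\<close> would be an odd multiple of the former and an even multiple of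
  the latter, giving \<open>1 \<equiv> -1\<close>.  So \<open>N / q\<close> is \<open>1\<close> modulo \<open>2\<^sup>m\<close>, and \<open>N < 2\<^bsup>2m\<^esup> - 1\<close> forces it to be \<open>1\<close>.
\<close>

section \<open>The ring of integers of the golden field\<close>

definition golden :: real where
  "golden = (1 + sqrt 5) / 2"

text \<open>The ring Z[phi], realised inside the reals so that ordinary real algebra and the
  binomial theorem apply directly.\<close>

definition golden_ints :: "real set" where
  "golden_ints = {of_int a + of_int b * golden | a b. True}"

text \<open>Congruence modulo the ideal generated by \<open>q\<close> in Z[phi]. Only the difference
  is constrained, so the multiplicative rules carry membership hypotheses.\<close>

definition golden_cong :: "int \<Rightarrow> real \<Rightarrow> real \<Rightarrow> bool" where
  "golden_cong q x y \<longleftrightarrow> (\<exists>z\<in>golden_ints. x - y = of_int q * z)"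

lemma golden_square: "golden * golden = golden + 1"
proof -
  have "sqrt 5 * sqrt 5 = (5 :: real)"
    by simp
  then show ?thesis
    unfolding golden_def by (simp add: field_simps)
qed

lemma golden_conjugate: "golden * (1 - golden) = -1"
  using golden_square by (simp add: algebra_simps)

lemma golden_intsI: "of_int a + of_int b * golden \<in> golden_ints"
  unfolding golden_ints_def by blast

lemma of_int_golden_ints [simp]: "of_int a \<in> golden_ints"
  using golden_intsI[of a 0] by simp

lemma of_nat_golden_ints [simp]: "of_nat n \<in> golden_ints"
  using of_int_golden_ints[of "int n"] by simp

lemma one_golden_ints [simp]: "1 \<in> golden_ints"
  using of_int_golden_ints[of 1] by simp

lemma zero_golden_ints [simp]: "0 \<in> golden_ints"
  using of_int_golden_ints[of 0] by simp

lemma numeral_golden_ints [simp]: "numeral n \<in> golden_ints"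
  using of_int_golden_ints[of "numeral n"] by simp

lemma golden_golden_ints [simp]: "golden \<in> golden_ints"
  using golden_intsI[of 0 1] by simp

lemma add_golden_ints [simp]:
  assumes "x \<in> golden_ints" "y \<in> golden_ints"
  shows "x + y \<in> golden_ints"
proof -
  obtain a b c d where "x = of_int a + of_int b * golden" "y = of_int c + of_int d * golden"
    using assms unfolding golden_ints_def by blast
  then have "x + y = of_int (a + c) + of_int (b + d) * golden"
    by (simp add: algebra_simps)
  then show ?thesis
    unfolding golden_ints_def by blast
qed

lemma mult_golden_ints [simp]:
  assumes "x \<in> golden_ints" "y \<in> golden_ints"
  shows "x * y \<in> golden_ints"
proof -
  obtain a b c d where xy: "x = of_int a + of_int b * golden" "y = of_int c + of_int d * golden"
    using assms unfolding golden_ints_def by blast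
  have "x * y = of_int (a * c) + of_int (a * d + b * c) * golden
      + of_int (b * d) * (golden * golden)"
    unfolding xy by (simp add: algebra_simps)
  also have "\<dots> = of_int (a * c + b * d) + of_int (a * d + b * c + b * d) * golden"
    unfolding golden_square by (simp add: algebra_simps)
  finally show ?thesis
    unfolding golden_ints_def by blast
qed

lemma uminus_golden_ints [simp]: "x \<in> golden_ints \<Longrightarrow> - x \<in> golden_ints"
  using mult_golden_ints[OF of_int_golden_ints[of "-1"], of x] by simp

lemma diff_golden_ints [simp]:
  "x \<in> golden_ints \<Longrightarrow> y \<in> golden_ints \<Longrightarrow> x - y \<in> golden_ints"
  using add_golden_ints[of x "- y"] by (simp del: add_golden_ints)

lemma power_golden_ints [simp]: "x \<in> golden_ints \<Longrightarrow> x ^ n \<in> golden_ints"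
  by (induction n) auto

lemma sum_golden_ints: "(\<And>i. i \<in> A \<Longrightarrow> f i \<in> golden_ints) \<Longrightarrow> sum f A \<in> golden_ints"
  by (induction A rule: infinite_finite_induct) auto

lemma sqrt5_golden_ints [simp]: "sqrt 5 \<in> golden_ints"
proof -
  have "sqrt 5 = 2 * golden - 1"
    by (simp add: golden_def field_simps)
  then show ?thesis by simp
qed

text \<open>Irrationality of \<open>sqrt 5\<close>: for nonzero \<open>b\<close> the exponent of 5
  would be even on the left and odd on the right.\<close>

lemma square_eq_5_square_int:
  fixes a b :: int
  assumes "a\<^sup>2 = 5 * b\<^sup>2"
  shows "b = 0"
proof (rule ccontr)
  assume "b \<noteq> 0"
  with assms have "a \<noteq> 0" by auto
  have p: "prime (5 :: int)" by simp
  then have e: "prime_elem (5 :: int)" by blast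
  have "multiplicity 5 (a\<^sup>2) = 2 * multiplicity 5 a"
    using e \<open>a \<noteq> 0\<close> by (simp add: prime_elem_multiplicity_power_distrib)
  moreover have "multiplicity 5 (5 * b\<^sup>2) = Suc (multiplicity 5 (b\<^sup>2))"
    using \<open>b \<noteq> 0\<close> by (intro multiplicity_times_same) auto
  moreover have "multiplicity 5 (b\<^sup>2) = 2 * multiplicity 5 b"
    using e \<open>b \<noteq> 0\<close> by (simp add: prime_elem_multiplicity_power_distrib)
  ultimately have "2 * multiplicity 5 a = Suc (2 * multiplicity 5 b)"
    using assms by simp
  then show False
    by presburger
qed

text \<open>1 and \<open>golden\<close> are linearly independent over the rationals, so the ideal
  generated by \<open>q\<close> meets the integers exactly in the multiples of
  \<open>q\<close>.\<close>

lemma golden_cong_of_int_iff: "golden_cong q (of_int a) (of_int b) \<longleftrightarrow> q dvd a - b"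
proof
  assume "golden_cong q (of_int a) (of_int b)"
  then obtain x y where xy: "of_int a - of_int b = of_int q * (of_int x + of_int y * golden)"
    unfolding golden_cong_def golden_ints_def by blast
  define d where "d = a - b - q * x"
  define e where "e = q * y"
  have "real_of_int d = of_int e * golden"
    using xy by (simp add: d_def e_def algebra_simps)
  \<comment> \<open>Doubling clears the denominator of \<open>golden\<close> and isolates
    \<open>sqrt 5\<close>.\<close>
  then have "real_of_int (2 * d - e) = of_int e * sqrt 5"
    by (simp add: golden_def field_simps)
  then have "(real_of_int (2 * d - e))\<^sup>2 = 5 * (of_int e)\<^sup>2"
    by (simp add: power_mult_distrib)
  then have "real_of_int ((2 * d - e)\<^sup>2) = real_of_int (5 * e\<^sup>2)"
    by simp
  then have "(2 * d - e)\<^sup>2 = 5 * e\<^sup>2"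
    by (simp only: of_int_eq_iff)
  then have "e = 0"
    by (rule square_eq_5_square_int)
  then have "d = 0"
    using \<open>real_of_int d = of_int e * golden\<close> by simp
  then show "q dvd a - b"
    by (simp add: d_def)
next
  assume "q dvd a - b"
  then obtain c where "a - b = q * c" ..
  then have "real_of_int a - of_int b = of_int q * of_int c"
    by (metis of_int_diff of_int_mult)
  then show "golden_cong q (of_int a) (of_int b)"
    unfolding golden_cong_def by (auto intro!: bexI[of _ "of_int c"])
qed

lemma golden_cong_refl [simp]: "golden_cong q x x"
  unfolding golden_cong_def by (auto intro!: bexI[of _ 0])

lemma golden_cong_sym: "golden_cong q x y \<Longrightarrow> golden_cong q y x"
  unfolding golden_cong_def
proof (elim bexE)
  fix z assume "z \<in> golden_ints" "x - y = of_int q * z"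
  then show "\<exists>z\<in>golden_ints. y - x = of_int q * z"
    by (intro bexI[of _ "- z"]) (auto simp: algebra_simps)
qed

lemma golden_cong_trans [trans]:
  assumes "golden_cong q x y" "golden_cong q y z"
  shows "golden_cong q x z"
proof -
  obtain u v where "u \<in> golden_ints" "v \<in> golden_ints"
    and "x - y = of_int q * u" "y - z = of_int q * v"
    using assms unfolding golden_cong_def by blast
  then show ?thesis
    unfolding golden_cong_def by (intro bexI[of _ "u + v"]) (auto simp: algebra_simps)
qed

lemma golden_cong_add:
  assumes "golden_cong q x y" "golden_cong q x' y'"
  shows "golden_cong q (x + x') (y + y')"
proof -
  obtain u v where "u \<in> golden_ints" "v \<in> golden_ints"
    and "x - y = of_int q * u" "x' - y' = of_int q * v"
    using assms unfolding golden_cong_def by blast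
  then show ?thesis
    unfolding golden_cong_def by (intro bexI[of _ "u + v"]) (auto simp: algebra_simps)
qed

lemma golden_cong_mult_left:
  assumes "golden_cong q x y" "c \<in> golden_ints"
  shows "golden_cong q (c * x) (c * y)"
proof -
  obtain u where "u \<in> golden_ints" "x - y = of_int q * u"
    using assms unfolding golden_cong_def by blast
  moreover from this have "c * x - c * y = of_int q * (c * u)"
    by (metis mult.left_commute right_diff_distrib)
  ultimately show ?thesis
    using assms(2) unfolding golden_cong_def by (intro bexI[of _ "c * u"]) auto
qed

lemma golden_cong_mult:
  assumes "golden_cong q x y" "golden_cong q x' y'" "x' \<in> golden_ints" "y \<in> golden_ints"
  shows "golden_cong q (x * x') (y * y')"
  using golden_cong_mult_left[OF assms(1,3)] golden_cong_mult_left[OF assms(2,4)]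
  by (auto simp: mult.commute intro: golden_cong_trans)

lemma golden_cong_power:
  assumes "golden_cong q x y" "x \<in> golden_ints" "y \<in> golden_ints"
  shows "golden_cong q (x ^ n) (y ^ n)"
  by (induction n) (use assms in \<open>auto intro: golden_cong_mult\<close>)

lemma golden_cong_dvd:
  assumes "golden_cong q x y" "p dvd q"
  shows "golden_cong p x y"
proof -
  obtain z where "z \<in> golden_ints" "x - y = of_int q * z"
    using assms unfolding golden_cong_def by blast
  moreover obtain c where "q = p * c"
    using assms by blast
  ultimately show ?thesis
    unfolding golden_cong_def by (intro bexI[of _ "of_int c * z"]) auto
qed

section \<open>The Frobenius map modulo an inert prime\<close>

text \<open>All inner binomial coefficients are divisible by \<open>p\<close>; \<open>z\<close>
  collects the exact quotients.\<close>

lemma golden_cong_prime_power_add: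
  assumes "prime p" "x \<in> golden_ints" "y \<in> golden_ints"
  shows "golden_cong (int p) ((x + y) ^ p) (x ^ p + y ^ p)"
proof -
  have "p > 1"
    using assms(1) by (rule prime_gt_1_nat)
  define t where "t = (\<lambda>k. of_nat (p choose k) * x ^ k * y ^ (p - k))"
  define z where "z = (\<Sum>k\<in>{1..<p}. of_nat ((p choose k) div p) * x ^ k * y ^ (p - k))"
  have "{..p} = insert 0 (insert p {1..<p})"
    using \<open>p > 1\<close> by auto
  then have "(x + y) ^ p = x ^ p + y ^ p + (\<Sum>k\<in>{1..<p}. t k)"
    using \<open>p > 1\<close> by (simp add: binomial_ring t_def)
  also have "(\<Sum>k\<in>{1..<p}. t k) = of_int (int p) * z"
    unfolding z_def sum_distrib_left
  proof (rule sum.cong)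
    fix k assume k: "k \<in> {1..<p}"
    then have "p dvd (p choose k)"
      using assms(1) by (intro dvd_choose_prime) auto
    then have "p choose k = p * ((p choose k) div p)"
      by simp
    then have "real (p choose k) = real p * real ((p choose k) div p)"
      by (metis of_nat_mult)
    then show "t k = of_int (int p) * (of_nat ((p choose k) div p) * x ^ k * y ^ (p - k))"
      by (simp add: t_def)
  qed simp
  finally have "(x + y) ^ p - (x ^ p + y ^ p) = of_int (int p) * z"
    by simp
  moreover have "z \<in> golden_ints"
    unfolding z_def by (rule sum_golden_ints) (use assms in auto)
  ultimately show ?thesis
    unfolding golden_cong_def by blast
qed

lemma not_QuadRes_5:
  assumes "q mod 5 = 2 \<or> q mod 5 = 3"
  shows "\<not> QuadRes 5 q"
proof
  assume "QuadRes 5 q"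
  then obtain y where y: "y\<^sup>2 mod 5 = q mod 5"
    unfolding QuadRes_def cong_def by blast
  have "y mod 5 \<in> {0, 1, 2, 3, 4}"
    by auto
  moreover have "y\<^sup>2 mod 5 = (y mod 5)\<^sup>2 mod 5"
    by (simp add: power_mod)
  ultimately have "y\<^sup>2 mod 5 \<in> {0, 1, 4}"
    by auto
  with y assms show False by auto
qed

text \<open>The reciprocity sign is 1 because \<open>(5 - 1) div 2\<close> is even, so 5 is a
  residue modulo \<open>p\<close> only if \<open>p\<close> is one modulo 5.\<close>

lemma Legendre_5_inert:
  assumes "prime p" "p > 2" "p mod 5 = 2 \<or> p mod 5 = 3"
  shows "Legendre 5 (int p) = -1"
proof -
  have "int p mod 5 = 2 \<or> int p mod 5 = 3"
    using assms(3) by presburger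
  then have "Legendre (int p) 5 = -1"
    using not_QuadRes_5[of "int p"] by (auto simp: Legendre_def cong_def)
  moreover have "Legendre (int p) (int 5) * Legendre (int 5) (int p)
      = (-1) ^ ((p - 1) div 2 * ((5 - 1) div 2))"
    by (rule Quadratic_Reciprocity) (use assms in auto)
  ultimately show ?thesis
    by (simp add: power_mult power2_eq_square flip: power_mult_distrib)
qed

text \<open>Euler's criterion gives \<open>sqrt 5 ^ p\<close> \<equiv> \<open>- sqrt 5\<close>, so
  the Frobenius map acts as conjugation, and \<open>golden\<close> times its conjugate is -1. The
  computation uses \<open>2 * golden = 1 + sqrt 5\<close> and cancels the 2 at the end.\<close>

lemma golden_power_inert_prime:
  assumes "prime p" "p > 2" "p mod 5 = 2 \<or> p mod 5 = 3"
  shows "golden_cong (int p) (golden ^ (p + 1)) (-1)"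
proof -
  have "odd p"
    using assms prime_odd_nat by blast
  then obtain h where h: "p = 2 * h + 1"
    by (rule oddE)
  have "[Legendre 5 (int p) = 5 ^ ((p - 1) div 2)] (mod int p)"
    using euler_criterion[OF assms(1,2)] .
  then have "[5 ^ h = -1] (mod int p)"
    using Legendre_5_inert[OF assms] h by (auto simp: cong_sym_eq)
  then have "golden_cong (int p) (of_int (5 ^ h)) (of_int (-1))"
    unfolding golden_cong_of_int_iff by (simp add: cong_iff_dvd_diff)
  then have "golden_cong (int p) (sqrt 5 * 5 ^ h) (sqrt 5 * (-1))"
    by (intro golden_cong_mult_left) auto
  moreover have "sqrt 5 ^ p = sqrt 5 * 5 ^ h"
    by (simp add: h power_mult)
  ultimately have sqrt5: "golden_cong (int p) (sqrt 5 ^ p) (- sqrt 5)"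
    by simp
  have "golden_cong (int p) ((1 + sqrt 5) ^ p) (1 ^ p + sqrt 5 ^ p)"
    by (rule golden_cong_prime_power_add) (use assms in auto)
  also have "golden_cong (int p) (1 ^ p + sqrt 5 ^ p) (1 + - sqrt 5)"
    by (rule golden_cong_add) (use sqrt5 in auto)
  also have "1 + - sqrt 5 = 2 * (1 - golden)"
    by (simp add: golden_def field_simps)
  also have "1 + sqrt 5 = 2 * golden"
    by (simp add: golden_def)
  finally have frob: "golden_cong (int p) (2 ^ p * golden ^ p) (2 * (1 - golden))"
    by (simp add: power_mult_distrib)
  \<comment> \<open>Fermat's little theorem for base 2, read off from
    \<open>(1 + 1) ^ p\<close>.\<close>
  have two: "golden_cong (int p) (2 ^ p) 2"
    using golden_cong_prime_power_add[OF assms(1), of 1 1] by simp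
  have "golden_cong (int p) (golden ^ p * 2) (golden ^ p * 2 ^ p)"
    by (intro golden_cong_mult_left golden_cong_sym[OF two]) auto
  also have "golden ^ p * 2 ^ p = 2 ^ p * golden ^ p"
    by simp
  also note frob
  \<comment> \<open>\<open>h + 1\<close> is the inverse of 2 modulo \<open>p\<close>\<close>
  finally have "golden_cong (int p) (of_nat (h + 1) * golden * (golden ^ p * 2))
      (of_nat (h + 1) * golden * (2 * (1 - golden)))"
    by (rule golden_cong_mult_left) auto
  moreover have "of_nat (h + 1) * golden * (golden ^ p * 2) = of_int (int p + 1) * golden ^ (p + 1)"
    by (simp add: h algebra_simps)
  moreover have "of_nat (h + 1) * golden * (2 * (1 - golden)) = of_int (- (int p + 1))"
  proof -
    have "of_nat (h + 1) * golden * (2 * (1 - golden)) = 2 * of_nat (h + 1) * (golden * (1 - golden))"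
      by (simp only: ac_simps)
    then show ?thesis
      unfolding golden_conjugate by (simp add: h)
  qed
  ultimately have "golden_cong (int p) (of_int (int p + 1) * golden ^ (p + 1)) (of_int (- (int p + 1)))"
    by (simp only:)
  moreover have "golden_cong (int p) (of_int (- (int p + 1))) (of_int (-1))"
    unfolding golden_cong_of_int_iff by simp
  moreover have "golden_cong (int p) (golden ^ (p + 1) * of_int 1) (golden ^ (p + 1) * of_int (int p + 1))"
    by (rule golden_cong_mult_left) (auto simp: golden_cong_of_int_iff simp del: of_int_1 of_int_add)
  ultimately show ?thesis
    by (auto simp: mult.commute intro: golden_cong_trans)
qed

section \<open>The Lucas sequence of the golden ratio\<close>

text \<open>Binet's formula: the squares of \<open>golden\<close> and its conjugate are the roots of
  t^2 - 3t + 1, the characteristic polynomial of the recurrence.\<close>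

lemma lucas_V_3_1: "of_int (lucas_V 3 1 n) = golden ^ (2 * n) + (1 - golden) ^ (2 * n)"
proof -
  define a where "a = golden * golden"
  define b where "b = (1 - golden) * (1 - golden)"
  have a: "a * a = 3 * a - 1"
    unfolding a_def golden_square using golden_square by (simp add: algebra_simps)
  have b: "b * b = 3 * b - 1"
  proof -
    have "b = 2 - golden"
      unfolding b_def using golden_square by (simp add: algebra_simps)
    show ?thesis
      unfolding \<open>b = 2 - golden\<close> using golden_square by (simp add: algebra_simps)
  qed
  have "of_int (lucas_V 3 1 n) = a ^ n + b ^ n"
  proof (induction n rule: induct_nat_012)
    case 1
    show ?case
      unfolding a_def b_def using golden_square by (simp add: algebra_simps)
  next
    case (ge2 n)
    have "a ^ n * (a * a) + b ^ n * (b * b) = a ^ n * (3 * a - 1) + b ^ n * (3 * b - 1)"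
      unfolding a b ..
    then show ?case
      using ge2 by (simp add: algebra_simps)
  qed auto
  then show ?thesis
    by (simp add: a_def b_def power_mult power2_eq_square)
qed

text \<open>Each step is the duplication formula V_2n = V_n^2 - 2 Q^n with Q = 1.\<close>

lemma S_seq_lucas_V: "S_seq (lucas_V 3 1 k) j = lucas_V 3 1 (k * 2 ^ j)"
proof (induction j)
  case (Suc j)
  define n where "n = k * 2 ^ j"
  define u where "u = golden ^ (2 * n)"
  define v where "v = (1 - golden) ^ (2 * n)"
  have uv: "u * v = 1"
    unfolding u_def v_def power_mult_distrib[symmetric] golden_conjugate by simp
  have "real_of_int (S_seq (lucas_V 3 1 k) (Suc j)) = (u + v)\<^sup>2 - 2"
    using Suc lucas_V_3_1[of n] by (simp add: n_def u_def v_def)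
  also have "\<dots> = u\<^sup>2 + v\<^sup>2"
    using uv by (simp add: power2_sum)
  also have "\<dots> = of_int (lucas_V 3 1 (2 * n))"
    unfolding lucas_V_3_1 by (simp add: u_def v_def power_mult[symmetric] ac_simps)
  finally show ?case
    unfolding of_int_eq_iff by (simp add: n_def ac_simps)
qed simp

text \<open>Here V_n = \<open>u + v\<close> with \<open>u * v = 1\<close>, hence
  \<open>u * (u + v) = u * u + 1\<close>. As \<open>u\<close> is a unit with inverse
  \<open>v\<close>, the implication can be reversed.\<close>

lemma dvd_lucas_V_3_1_iff:
  "q dvd lucas_V 3 1 n \<longleftrightarrow> golden_cong q (golden ^ (4 * n)) (-1)"
proof -
  define u where "u = golden ^ (2 * n)"
  define v where "v = (1 - golden) ^ (2 * n)"
  have uv: "u * v = 1"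
    unfolding u_def v_def power_mult_distrib[symmetric] golden_conjugate by simp
  have uu: "golden ^ (4 * n) = u * u"
    by (simp add: u_def power_add[symmetric])
  have ring: "u \<in> golden_ints" "v \<in> golden_ints"
    by (auto simp: u_def v_def)
  have "q dvd lucas_V 3 1 n \<longleftrightarrow> golden_cong q (u + v) 0"
    using golden_cong_of_int_iff[of q "lucas_V 3 1 n" 0] lucas_V_3_1[of n]
    by (simp add: u_def v_def)
  also have "\<dots> \<longleftrightarrow> golden_cong q (u * u) (-1)"
  proof
    assume "golden_cong q (u + v) 0"
    from golden_cong_add[OF golden_cong_mult_left[OF this ring(1)] golden_cong_refl[of q "-1"]]
    show "golden_cong q (u * u) (-1)"
      using uv by (simp add: algebra_simps)
  next
    assume "golden_cong q (u * u) (-1)"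
    \<comment> \<open>Multiply by \<open>v\<close>, the inverse of \<open>u\<close>, then add
      \<open>v\<close> to both sides.\<close>
    from golden_cong_add[OF golden_cong_mult_left[OF this ring(2)] golden_cong_refl[of q v]]
    have "golden_cong q (u * v * u + v) 0"
      by (simp add: ac_simps)
    then show "golden_cong q (u + v) 0"
      unfolding uv by simp
  qed
  finally show ?thesis
    unfolding uu .
qed

section \<open>The primality criterion\<close>

text \<open>The residues 0, 1, 4 modulo 5 are closed under multiplication, so when a prime factor
  has one of them, the search descends to the cofactor.\<close>

lemma prime_factor_2_3_mod_5:
  fixes n :: nat
  assumes "n mod 5 = 2 \<or> n mod 5 = 3"
  obtains p where "prime p" "p dvd n" "p mod 5 = 2 \<or> p mod 5 = 3"
proof -
  have "\<exists>p. prime p \<and> p dvd n \<and> (p mod 5 = 2 \<or> p mod 5 = 3)"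
    using assms
  proof (induction n rule: less_induct)
    case (less n)
    have "n \<noteq> 1" "n > 0"
      using less.prems by (auto intro!: gr0I)
    then obtain p where p: "prime p" "p dvd n"
      using prime_factor_nat by blast
    then obtain c where c: "n = p * c"
      by blast
    have pc: "n mod 5 = (p mod 5) * (c mod 5) mod 5"
      by (simp add: c mod_mult_eq)
    have "p mod 5 \<in> {0, 1, 2, 3, 4}" "c mod 5 \<in> {0, 1, 2, 3, 4}"
      by auto
    then have "(p mod 5 = 2 \<or> p mod 5 = 3) \<or> (c mod 5 = 2 \<or> c mod 5 = 3)"
      using pc less.prems by auto
    moreover have "c < n"
      using c \<open>n > 0\<close> prime_gt_1_nat[OF p(1)] by simp
    ultimately show ?case
      using p less.IH[of c] c by (metis dvd_mult)
  qed
  then show ?thesis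
    using that by blast
qed

text \<open>Since 1 and -1 differ modulo \<open>q\<close>, any exponent giving -1 has 2-adic
  valuation exactly one below that of the order of \<open>golden\<close> modulo \<open>q\<close>.
  Hence \<open>n\<close> and \<open>k * 2 ^ m\<close> contain the same power of 2.\<close>

lemma power_2_dvd_if_golden_cong:
  fixes q :: int and n :: nat
  assumes "\<not> q dvd 2" "n > 0"
    and n: "golden_cong q (golden ^ n) (-1)"
    and k: "golden_cong q (golden ^ (k * 2 ^ m)) (-1)"
  shows "2 ^ m dvd n"
proof (rule ccontr)
  assume ndvd: "\<not> 2 ^ m dvd n"
  obtain s t where st: "n = 2 ^ s * t" "odd t"
    using \<open>n > 0\<close> by (metis gr0_conv_Suc multiplicity_decompose' neq0_conv not_prime_unit two_is_prime_nat)
  have "s < m"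
    using ndvd st by (metis dvd_triv_left le_imp_power_dvd dvd_trans not_le)
  \<comment> \<open>The common multiple: an even multiple of \<open>n\<close>, as
    \<open>s < m\<close>, and an odd multiple of \<open>k * 2 ^ m\<close>, as \<open>t\<close> is
    odd.\<close>
  have eq: "n * (k * 2 ^ (m - s)) = k * 2 ^ m * t"
  proof -
    have "(2 :: nat) ^ m = 2 ^ s * 2 ^ (m - s)"
      using \<open>s < m\<close> by (simp flip: power_add)
    then show ?thesis
      by (simp add: st)
  qed
  have "golden_cong q ((golden ^ n) ^ (k * 2 ^ (m - s))) ((-1) ^ (k * 2 ^ (m - s)))"
    using n by (rule golden_cong_power) auto
  also have "(-1 :: real) ^ (k * 2 ^ (m - s)) = 1"
    using \<open>s < m\<close> by simp
  also have "(golden ^ n) ^ (k * 2 ^ (m - s)) = (golden ^ (k * 2 ^ m)) ^ t"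
    by (simp only: eq flip: power_mult)
  finally have one: "golden_cong q 1 ((golden ^ (k * 2 ^ m)) ^ t)"
    by (rule golden_cong_sym)
  have "golden_cong q ((golden ^ (k * 2 ^ m)) ^ t) ((-1) ^ t)"
    using k by (rule golden_cong_power) auto
  then have "golden_cong q 1 (-1)"
    using golden_cong_trans[OF one] \<open>odd t\<close> by simp
  then have "q dvd 2"
    using golden_cong_of_int_iff[of q 1 "-1"] by simp
  with assms(1) show False ..
qed

text \<open>Both \<open>p\<close> and \<open>p * c\<close> are -1 modulo \<open>M\<close>, so
  \<open>c\<close> is 1 modulo \<open>M\<close>; any value other than 1 is then at least
  \<open>M + 1\<close>, which makes \<open>p * c\<close> too large.\<close>

lemma cofactor_eq_1:
  fixes p c k M :: nat
  assumes "k < M" "M > 1" "p * c + 1 = k * M" "M dvd p + 1"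
  shows "c = 1"
proof -
  have "M dvd (p + 1) * c" "M dvd p * c + 1"
    using dvd_mult2[OF assms(4)] assms(3) by auto
  \<comment> \<open>The difference equals \<open>c - 1\<close>; working in \<open>int\<close> avoids
    truncated subtraction.\<close>
  then have "int M dvd int ((p + 1) * c) - int (p * c + 1)"
    by (intro dvd_diff) (simp_all only: int_dvd_int_iff)
  then have "int M dvd int c - 1"
    by (simp add: algebra_simps)
  then obtain b where b: "int c = 1 + int M * b"
    by (metis add.commute diff_add_cancel dvdE)
  have "c > 0"
    using assms by (intro gr0I) auto
  have "b \<ge> 0"
  proof (rule ccontr)
    assume "\<not> b \<ge> 0"
    then have "int M * b \<le> int M * (-1)"
      by (intro mult_left_mono) auto
    then show False
      using b \<open>c > 0\<close> \<open>M > 1\<close> by simp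
  qed
  moreover have "\<not> b \<ge> 1"
  proof
    assume "b \<ge> 1"
    then have "int M * 1 \<le> int M * b"
      by (intro mult_left_mono) auto
    then have "c \<ge> M + 1"
      using b by simp
    moreover have "M \<le> p + 1"
      using assms(4) by (intro dvd_imp_le) auto
    \<comment> \<open>This yields \<open>p * c + 1\<close> \<ge> \<open>M * M\<close>, whereas
      \<open>k < M\<close> makes \<open>k * M\<close> smaller.\<close>
    ultimately have "(M - 1) * (M + 1) \<le> p * c"
      by (intro mult_mono) auto
    moreover have "(M - 1) * (M + 1) + 1 = M * M"
      using \<open>M > 1\<close> by (simp add: algebra_simps)
    moreover have "k * M < M * M"
      using assms by simp
    ultimately show False
      using assms(3) by linarith
  qed
  ultimately have "b = 0"
    by simp
  then show ?thesis
    using b by simp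
qed

text \<open>As 16 is 1 modulo 5, \<open>2 ^ m\<close> depends only on \<open>m mod 4\<close>; in
  each listed case \<open>k * 2 ^ m\<close> is 3 or 4 modulo 5.\<close>

lemma mod_5_eq_2_or_3:
  fixes k m :: nat
  assumes "([k = 1] (mod 10) \<and> ([m = 2] (mod 4) \<or> [m = 3] (mod 4))) \<or>
         ([k = 3] (mod 10) \<and> ([m = 0] (mod 4) \<or> [m = 3] (mod 4))) \<or>
         ([k = 7] (mod 10) \<and> ([m = 1] (mod 4) \<or> [m = 2] (mod 4))) \<or>
         ([k = 9] (mod 10) \<and> ([m = 0] (mod 4) \<or> [m = 1] (mod 4)))"
    and "n + 1 = k * 2 ^ m"
  shows "n mod 5 = 2 \<or> n mod 5 = 3"
proof -
  have "(2 :: nat) ^ m = 16 ^ (m div 4) * 2 ^ (m mod 4)"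
    using power_add[of "2 :: nat" "4 * (m div 4)" "m mod 4"] by (simp add: power_mult)
  moreover have "(16 :: nat) ^ (m div 4) mod 5 = 1"
    using power_mod[of "16 :: nat" 5 "m div 4"] by simp
  ultimately have m: "(2 :: nat) ^ m mod 5 = 2 ^ (m mod 4) mod 5"
    by (metis mod_mult_left_eq mult_1)
  have k: "k mod 5 = k mod 10 mod 5"
    by (simp add: mod_mod_cancel)
  have "(n + 1) mod 5 = (k mod 10 mod 5) * (2 ^ (m mod 4) mod 5) mod 5"
    unfolding assms(2) by (metis m k mod_mult_eq)
  then have "(n + 1) mod 5 = 3 \<or> (n + 1) mod 5 = 4"
    using assms(1) by (auto simp: cong_def)
  then show ?thesis
    by presburger
qed

theorem theorem3p1:
  fixes m k :: nat and N x :: int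
  assumes "m > 2" and "0 < k" and "k < 2 ^ m" and "3 dvd k"
    and "N = int k * 2 ^ m - 1"
    and "([k = 1] (mod 10) \<and> ([m = 2] (mod 4) \<or> [m = 3] (mod 4))) \<or>
         ([k = 3] (mod 10) \<and> ([m = 0] (mod 4) \<or> [m = 3] (mod 4))) \<or>
         ([k = 7] (mod 10) \<and> ([m = 1] (mod 4) \<or> [m = 2] (mod 4))) \<or>
         ([k = 9] (mod 10) \<and> ([m = 0] (mod 4) \<or> [m = 1] (mod 4)))"
    and "x = lucas_V 3 1 k"
  shows "prime N \<longleftrightarrow> N dvd S_seq x (m - 2)"
proof -
  define n where "n = k * 2 ^ m - 1"
  have n: "n + 1 = k * 2 ^ m"
    using assms(2) by (simp add: n_def)
  then have "int n + 1 = int k * 2 ^ m"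
    by (metis of_nat_1 of_nat_add of_nat_mult of_nat_numeral of_nat_power)
  then have N: "N = int n"
    using assms(5) by simp
  have n_mod_5: "n mod 5 = 2 \<or> n mod 5 = 3"
    using mod_5_eq_2_or_3[OF assms(6) n] .
  have "even (n + 1)"
    unfolding n using assms(1) by simp
  then have "odd n" by simp
  \<comment> \<open>The index \<open>m - 2\<close> compensates for the exponent \<open>4 * n\<close>
    in \<open>dvd_lucas_V_3_1_iff\<close>.\<close>
  have "(2 :: nat) ^ m = 2 ^ 2 * 2 ^ (m - 2)"
    unfolding power_add[symmetric] using assms(1) by (simp only: le_add_diff_inverse)
  then have "4 * (k * 2 ^ (m - 2)) = k * 2 ^ m"
    by simp
  then have crit: "N dvd S_seq x (m - 2) \<longleftrightarrow> golden_cong (int n) (golden ^ (k * 2 ^ m)) (-1)"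
    unfolding assms(7) S_seq_lucas_V N dvd_lucas_V_3_1_iff by (simp only:)
  show ?thesis
  proof
    assume "prime N"
    then have "prime n"
      by (simp add: N)
    moreover from this have "n > 2"
      using \<open>odd n\<close> prime_ge_2_nat[of n] by (cases "n = 2") auto
    ultimately show "N dvd S_seq x (m - 2)"
      using golden_power_inert_prime[of n] n_mod_5 unfolding crit n by blast
  next
    assume "N dvd S_seq x (m - 2)"
    then have cong: "golden_cong (int n) (golden ^ (k * 2 ^ m)) (-1)"
      by (simp only: crit)
    obtain p where p: "prime p" "p dvd n" "p mod 5 = 2 \<or> p mod 5 = 3"
      using prime_factor_2_3_mod_5[OF n_mod_5] .
    \<comment> \<open>The prime 2 also has residue 2 modulo 5, so it must be excluded through the
      parity of \<open>n\<close>.\<close>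
    have "p \<noteq> 2"
      using p(2) \<open>odd n\<close> by blast
    then have "p > 2"
      using prime_ge_2_nat[OF p(1)] by simp
    have "2 ^ m dvd p + 1"
    proof (rule power_2_dvd_if_golden_cong)
      show "\<not> int p dvd 2"
        using \<open>p > 2\<close> by (auto dest: zdvd_imp_le)
      show "golden_cong (int p) (golden ^ (p + 1)) (-1)"
        using golden_power_inert_prime[OF p(1) \<open>p > 2\<close> p(3)] .
      \<comment> \<open>The congruence modulo \<open>n\<close> descends to its divisor
        \<open>p\<close>.\<close>
      show "golden_cong (int p) (golden ^ (k * 2 ^ m)) (-1)"
        using cong p(2) by (rule golden_cong_dvd[OF _ iffD2[OF int_dvd_int_iff]])
    qed simp
    obtain c where c: "n = p * c"
      using p(2) by blast
    have "c = 1"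
    proof (rule cofactor_eq_1)
      show "p * c + 1 = k * 2 ^ m"
        using n c by simp
      show "(1 :: nat) < 2 ^ m"
        using assms(1) by (intro one_less_power) auto
    qed (use assms(3) \<open>2 ^ m dvd p + 1\<close> in auto)
    then show "prime N"
      using p(1) c N by simp
  qed
qed

end
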